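(* Let $p\in(1,2]$, $q\in(1,\infty)$, $a>0$ with $a>\frac dp-\frac d2$, $s>0$ and $\varrho>0$. Let $F_a:\mathcal D\subset B^0_{p,q}(\mathbb T^d)\to L^2(\mathbb T^d)$, with $\mathcal D$ containing $\{f:\|f\|_{B^s_{p,\infty}}\le\varrho\}$, satisfy for some $L>0$ $$\|F_a(f_1)-F_a(f_2)\|_{L^2}\le L\|f_1-f_2\|_{B^{-a}_{2,2}}\qquad\text{for all } f_1,f_2\in\mathcal D.$$ Then there cannot exist a reconstruction method (i.e. an arbitrary map) $R:L^2(\mathbb T^d)\to B^0_{p,q}(\mathbb T^d)$ satisfying the worst case error bound $$\sup\Big\{\|f-R(g^{\mathrm{obs}})\|_{B^0_{p,q}}:\ \|f\|_{B^s_{p,\infty}}\le\varrho,\ g^{\mathrm{obs}}\in L^2(\mathbb T^d),\ \|F_a(f)-g^{\mathrm{obs}}\|_{L^2}\le\delta\Big\}=o\Big(\varrho^{\frac a{s+a}}\delta^{\frac s{s+a}}\Big)\qquad\text{as }\delta\to0.$$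
   Context: $\mathbb T^d=\mathbb R^d/\mathbb Z^d$ and $B^s_{p,q}=B^s_{p,q}(\mathbb T^d)$ are the Besov spaces on the torus, equipped with any fixed equivalent norms. *)

theory Defs
  imports "HOL-Analysis.Analysis" "HOL-Library.Landau_Symbols" "HOL-Library.Function_Algebras"
begin

section \<open>Smooth functions and periodic test functions\<close>

definition partial_deriv :: "'d::finite \<Rightarrow> (real^'d \<Rightarrow> 'b::real_normed_vector) \<Rightarrow> real^'d \<Rightarrow> 'b" where
  "partial_deriv i f = (\<lambda>x. frechet_derivative f (at x) (axis i 1))"

definition partial_derivs :: "'d::finite list \<Rightarrow> (real^'d \<Rightarrow> 'b::real_normed_vector) \<Rightarrow> real^'d \<Rightarrow> 'b" where
  "partial_derivs is f = foldr partial_deriv is f"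

text \<open>All iterated partial derivatives are differentiable everywhere, i.e. \<open>f\<close> is \<open>C\<^sup>\<infinity>\<close>.\<close>

definition smooth :: "(real^'d::finite \<Rightarrow> 'b::real_normed_vector) \<Rightarrow> bool" where
  "smooth f \<longleftrightarrow> (\<forall>is x. partial_derivs is f differentiable (at x))"

definition int_lattice :: "(real^'d::finite) set" where
  "int_lattice = {k. \<forall>i. k $ i \<in> \<int>}"

text \<open>Functions on the torus \<open>\<real>\<^sup>d/\<int>\<^sup>d\<close> are functions on \<open>\<real>\<^sup>d\<close> that are periodic under \<open>\<int>\<^sup>d\<close>.\<close>

definition periodic :: "(real^'d::finite \<Rightarrow> 'b) \<Rightarrow> bool" where
  "periodic f \<longleftrightarrow> (\<forall>k\<in>int_lattice. \<forall>x. f (x + k) = f x)"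

definition test_fun :: "(real^'d::finite \<Rightarrow> complex) set" where
  "test_fun = {\<psi>. smooth \<psi> \<and> periodic \<psi>}"

section \<open>Distributions on the torus\<close>

text \<open>Continuous linear functionals on the test functions: the last conjunct is continuity with
  respect to the seminorms \<open>max\<^bsub>|\<alpha>| \<le> N\<^esub> sup |\<partial>\<^sup>\<alpha> \<psi>|\<close>. Functionals are extended by \<open>0\<close> outside the test
  functions, so that equality of distributions is equality in HOL and the vector space operations
  are pointwise.\<close>

definition torus_distr :: "((real^'d::finite \<Rightarrow> complex) \<Rightarrow> complex) set" where
  "torus_distr = {u.
     (\<forall>\<psi>. \<psi> \<notin> test_fun \<longrightarrow> u \<psi> = 0) \<and>
     (\<forall>\<psi>\<in>test_fun. \<forall>\<eta>\<in>test_fun. u (\<lambda>x. \<psi> x + \<eta> x) = u \<psi> + u \<eta>) \<and>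
     (\<forall>\<psi>\<in>test_fun. \<forall>c. u (\<lambda>x. c * \<psi> x) = c * u \<psi>) \<and>
     (\<exists>N C. \<forall>\<psi>\<in>test_fun. \<forall>B.
        (\<forall>is x. length is \<le> N \<longrightarrow> norm (partial_derivs is \<psi> x) \<le> B) \<longrightarrow> norm (u \<psi>) \<le> C * B)}"

definition fourier_char :: "real^'d::finite \<Rightarrow> real^'d \<Rightarrow> complex" where
  "fourier_char k x = cis (2 * pi * (k \<bullet> x))"

definition fourier_coeff :: "((real^'d::finite \<Rightarrow> complex) \<Rightarrow> complex) \<Rightarrow> real^'d \<Rightarrow> complex" where
  "fourier_coeff u k = u (fourier_char (- k))"

section \<open>Lebesgue spaces on the torus\<close>

text \<open>Integration over the torus is integration over the fundamental domain \<open>[0,1]\<^sup>d\<close>.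
  Elements of \<open>L\<^sup>p\<close> are represented by functions; equality in \<open>L\<^sup>p\<close> is \<open>torus_ae_eq\<close>.\<close>

definition torus_measure :: "(real^'d::finite) measure" where
  "torus_measure = lebesgue_on (cbox 0 (\<chi> i. 1))"

definition torus_Lp :: "real \<Rightarrow> (real^'d::finite \<Rightarrow> complex) set" where
  "torus_Lp p = {g. periodic g \<and> g \<in> borel_measurable lebesgue \<and>
     integrable torus_measure (\<lambda>x. norm (g x) powr p)}"

definition torus_Lp_norm :: "real \<Rightarrow> (real^'d::finite \<Rightarrow> complex) \<Rightarrow> real" where
  "torus_Lp_norm p g = (LINT x|torus_measure. norm (g x) powr p) powr (1 / p)"

definition torus_ae_eq :: "(real^'d::finite \<Rightarrow> complex) \<Rightarrow> (real^'d \<Rightarrow> complex) \<Rightarrow> bool" where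
  "torus_ae_eq g h \<longleftrightarrow> (AE x in torus_measure. g x = h x)"

section \<open>Besov spaces on the torus\<close>

text \<open>A function \<open>\<phi>\<close> generating a smooth dyadic resolution of unity
  \<open>1 = \<Sum>j. dyadic_cutoff \<phi> j\<close> on frequency space.\<close>

definition dyadic_generator :: "(real^'d::finite \<Rightarrow> real) \<Rightarrow> bool" where
  "dyadic_generator \<phi> \<longleftrightarrow> smooth \<phi> \<and> (\<forall>x. norm x \<le> 1 \<longrightarrow> \<phi> x = 1) \<and> (\<forall>x. norm x \<ge> 2 \<longrightarrow> \<phi> x = 0)"

definition dyadic_cutoff :: "(real^'d::finite \<Rightarrow> real) \<Rightarrow> nat \<Rightarrow> real^'d \<Rightarrow> real" where
  "dyadic_cutoff \<phi> j x =
     (if j = 0 then \<phi> x else \<phi> (x /\<^sub>R 2 ^ j) - \<phi> (x /\<^sub>R 2 ^ (j - 1)))"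

text \<open>The \<open>j\<close>-th Littlewood--Paley block of \<open>u\<close>, a trigonometric polynomial. The index set is
  finite when \<open>\<phi>\<close> is a dyadic generator.\<close>

definition lp_block ::
  "(real^'d::finite \<Rightarrow> real) \<Rightarrow> nat \<Rightarrow> ((real^'d \<Rightarrow> complex) \<Rightarrow> complex) \<Rightarrow> real^'d \<Rightarrow> complex" where
  "lp_block \<phi> j u x =
     (\<Sum>k\<in>{k\<in>int_lattice. dyadic_cutoff \<phi> j k \<noteq> 0}.
        of_real (dyadic_cutoff \<phi> j k) * fourier_coeff u k * fourier_char k x)"

definition besov_seq ::
  "(real^'d::finite \<Rightarrow> real) \<Rightarrow> real \<Rightarrow> real \<Rightarrow> ((real^'d \<Rightarrow> complex) \<Rightarrow> complex) \<Rightarrow> nat \<Rightarrow> real" where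
  "besov_seq \<phi> s p u j = 2 powr (real j * s) * torus_Lp_norm p (lp_block \<phi> j u)"

text \<open>\<open>B\<^sup>s\<^bsub>p,q\<^esub>\<close> for real \<open>s\<close>, \<open>1 \<le> p < \<infinity>\<close> and \<open>1 \<le> q \<le> \<infinity>\<close>.\<close>

definition besov ::
  "(real^'d::finite \<Rightarrow> real) \<Rightarrow> real \<Rightarrow> real \<Rightarrow> ereal \<Rightarrow> ((real^'d \<Rightarrow> complex) \<Rightarrow> complex) set" where
  "besov \<phi> s p q = {u \<in> torus_distr.
     if q = \<infinity> then bdd_above (range (besov_seq \<phi> s p u))
     else summable (\<lambda>j. besov_seq \<phi> s p u j powr real_of_ereal q)}"

definition besov_norm ::
  "(real^'d::finite \<Rightarrow> real) \<Rightarrow> real \<Rightarrow> real \<Rightarrow> ereal \<Rightarrow> ((real^'d \<Rightarrow> complex) \<Rightarrow> complex) \<Rightarrow> real" where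
  "besov_norm \<phi> s p q u =
     (if q = \<infinity> then (SUP j. besov_seq \<phi> s p u j)
      else (\<Sum>j. besov_seq \<phi> s p u j powr real_of_ereal q) powr (1 / real_of_ereal q))"

text \<open>\<open>N\<close> is a norm on the complex vector space \<open>V\<close>, equivalent there to \<open>N\<^sub>0\<close>.\<close>

definition equivalent_norm ::
  "('a \<Rightarrow> complex) set \<Rightarrow> (('a \<Rightarrow> complex) \<Rightarrow> real) \<Rightarrow> (('a \<Rightarrow> complex) \<Rightarrow> real) \<Rightarrow> bool" where
  "equivalent_norm V N\<^sub>0 N \<longleftrightarrow>
     (\<forall>u\<in>V. 0 \<le> N u) \<and>
     (\<forall>u\<in>V. N u = 0 \<longleftrightarrow> u = 0) \<and>
     (\<forall>u\<in>V. \<forall>c. N (\<lambda>\<psi>. c * u \<psi>) = norm c * N u) \<and>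
     (\<forall>u\<in>V. \<forall>v\<in>V. N (u + v) \<le> N u + N v) \<and>
     (\<exists>c C. 0 < c \<and> 0 < C \<and> (\<forall>u\<in>V. c * N\<^sub>0 u \<le> N u \<and> N u \<le> C * N\<^sub>0 u))"

section \<open>Reconstruction\<close>

text \<open>A map from \<open>L\<^sup>2\<close> to \<open>V\<close>, given on representatives.\<close>

definition reconstruction_method ::
  "'v set \<Rightarrow> ((real^'d::finite \<Rightarrow> complex) \<Rightarrow> 'v) \<Rightarrow> bool" where
  "reconstruction_method V R \<longleftrightarrow>
     (\<forall>g\<in>torus_Lp 2. R g \<in> V) \<and>
     (\<forall>g\<in>torus_Lp 2. \<forall>h\<in>torus_Lp 2. torus_ae_eq g h \<longrightarrow> R g = R h)"

text \<open>Worst case error over the source set \<open>K\<close> at noise level \<open>\<delta>\<close>, measured in \<open>N\<close>; possibly \<open>\<infinity>\<close>.\<close>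

definition worst_case_error ::
  "('v::minus \<Rightarrow> real) \<Rightarrow> 'v set \<Rightarrow> ('v \<Rightarrow> real^'d::finite \<Rightarrow> complex) \<Rightarrow>
   ((real^'d \<Rightarrow> complex) \<Rightarrow> 'v) \<Rightarrow> real \<Rightarrow> ennreal" where
  "worst_case_error N K F R \<delta> =
     (SUP (f, g) \<in> {(f, g). f \<in> K \<and> g \<in> torus_Lp 2 \<and> torus_Lp_norm 2 (F f - g) \<le> \<delta>}.
        ennreal (N (f - R g)))"

end

theory Submission imports Defs begin

text \<open>The single-frequency distributions \<open>f\<^sub>n = c\<^sub>n e\<^bsub>k\<^esub>\<close> with \<open>|k| = 2\<^sup>n\<close> and \<open>c\<^sub>n \<sim> \<rho> 2\<^bsup>-ns\<^esup>\<close> lie in the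
  source set, and \<open>\<parallel>F f\<^sub>n - F 0\<parallel> \<le> \<delta>\<^sub>n\<close> for some \<open>\<delta>\<^sub>n \<sim> \<rho> 2\<^bsup>-n(s+a)\<^esup>\<close>. Hence \<open>f\<^sub>n\<close> and \<open>0\<close> are both compatible
  with the data \<open>F 0\<close> at noise level \<open>\<delta>\<^sub>n\<close>, and the worst case error at \<open>\<delta>\<^sub>n\<close> is at least half of
  \<open>\<parallel>f\<^sub>n\<parallel> \<sim> c\<^sub>n \<sim> \<rho>\<^bsup>a/(s+a)\<^esup> (\<delta>\<^sub>n)\<^bsup>s/(s+a)\<^esup>\<close>. Since \<open>2\<^sup>n\<close> is a dyadic frequency, \<open>e\<^bsub>k\<^esub>\<close> has exactly one nonzero
  Littlewood--Paley block, and all its Besov norms are explicit.\<close>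

section \<open>Integrals of characters over the torus\<close>

text \<open>Fubini for a product of one-variable functions: \<open>lborel\<close> is the image of
  the product of one-dimensional Lebesgue measures under the coordinate map.\<close>

lemma integral_lborel_prod:
  fixes f :: "'a::euclidean_space \<Rightarrow> real \<Rightarrow> 'c::{real_normed_field,banach,second_countable_topology}"
  assumes "\<And>b. b \<in> Basis \<Longrightarrow> integrable lborel (f b)"
  shows "(LINT x|lborel. (\<Prod>b\<in>Basis. f b (x \<bullet> b))) = (\<Prod>b\<in>Basis. (LINT t|lborel. f b t))"
proof -
  interpret product_sigma_finite "\<lambda>_::'a. lborel :: real measure" ..
  have meas: "f b \<in> borel_measurable borel" if "b \<in> Basis" for b
    using borel_measurable_integrable[OF assms[OF that]] by simp
  have "(\<lambda>x. \<Prod>b\<in>Basis. f b (x \<bullet> b)) \<in> borel_measurable borel"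
    by (intro borel_measurable_prod measurable_compose[OF _ meas]) auto
  then have "(LINT x|lborel. (\<Prod>b\<in>Basis. f b (x \<bullet> b))) =
      (LINT g|(\<Pi>\<^sub>M b\<in>(Basis::'a set). lborel). (\<Prod>b\<in>Basis. f b ((\<Sum>c\<in>Basis. g c *\<^sub>R c) \<bullet> b)))"
    by (subst lborel_eq, subst integral_distr) auto
  also have "\<dots> = (LINT g|(\<Pi>\<^sub>M b\<in>(Basis::'a set). lborel). (\<Prod>b\<in>Basis. f b (g b)))"
    by (intro Bochner_Integration.integral_cong prod.cong) auto
  also have "\<dots> = (\<Prod>b\<in>Basis. (LINT t|lborel. f b t))"
    by (rule product_integral_prod) (auto intro: assms)
  finally show ?thesis .
qed

lemma integral_cis_unit_interval:
  fixes m :: real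
  assumes "m \<in> \<int>"
  shows "(LINT t|lborel. indicator {0..1} t *\<^sub>R cis (2 * pi * (m * t))) = (if m = 0 then 1 else 0)"
proof (cases "m = 0")
  case True
  then show ?thesis by (simp add: cis_zero)
next
  case False
  \<comment> \<open>An antiderivative of the integrand; for an integer m it takes equal values at 0
    and 1.\<close>
  define G where "G t = cis (2 * pi * (m * t)) / (\<i> * of_real (2 * pi * m))" for t :: real
  have "(LINT t|lborel. indicator {0..1} t *\<^sub>R cis (2 * pi * (m * t))) = G 1 - G 0"
  proof (rule integral_FTC_Icc)
    fix t :: real
    show "(G has_vector_derivative cis (2 * pi * (m * t))) (at t within {0..1})"
      unfolding G_def cis_conv_exp using False
      by (auto intro!: derivative_eq_intros has_vector_derivative_real_field simp: field_simps)
  qed (auto intro!: continuous_intros)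
  also have "cis (2 * pi * m) = 1"
    using cis_multiple_2pi[OF assms] by (simp add: mult.commute mult.left_commute)
  then have "G 1 - G 0 = 0" by (simp add: G_def)
  finally show ?thesis using False by simp
qed

lemma continuous_fourier_char [continuous_intros]: "continuous_on S (fourier_char k)"
  unfolding fourier_char_def by (intro continuous_intros)

lemma norm_fourier_char [simp]: "norm (fourier_char k x) = 1"
  by (simp add: fourier_char_def)

lemma fourier_char_mult: "fourier_char k x * fourier_char m x = fourier_char (k + m) x"
  by (simp add: fourier_char_def cis_mult inner_add_left algebra_simps)

lemma fourier_char_prod:
  "fourier_char k x = (\<Prod>b\<in>Basis. cis (2 * pi * ((k \<bullet> b) * (x \<bullet> b))))"
proof -
  have "fourier_char k x = cis (\<Sum>b\<in>Basis. 2 * pi * ((k \<bullet> b) * (x \<bullet> b)))"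
    unfolding fourier_char_def by (subst euclidean_inner) (simp add: sum_distrib_left)
  also have "\<dots> = (\<Prod>b\<in>Basis. cis (2 * pi * ((k \<bullet> b) * (x \<bullet> b))))"
    by (induction rule: finite_induct[OF finite_Basis]) (auto simp: cis_mult[symmetric])
  finally show ?thesis .
qed

text \<open>Both the indicator of the unit cube and the character factor over the coordinates, so
  the integral is a product of one-dimensional ones. A single nonzero frequency component makes the
  product vanish.\<close>

lemma integral_fourier_char:
  fixes k :: "real^'d::finite"
  assumes "k \<in> int_lattice"
  shows "(LINT x|torus_measure. fourier_char k x) = (if k = 0 then 1 else 0)"
proof -
  let ?C = "cbox 0 (\<chi> i. 1) :: (real^'d) set"
  let ?f = "\<lambda>b t. indicator {0..1::real} t *\<^sub>R cis (2 * pi * ((k \<bullet> b) * t))"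
  have int: "k \<bullet> b \<in> \<int>" if "b \<in> Basis" for b
    using assms that by (auto simp: int_lattice_def Basis_vec_def inner_axis)
  have ind: "indicator ?C x = (\<Prod>b\<in>Basis. indicator {0..1::real} (x \<bullet> b) :: real)" for x
  proof (cases "x \<in> ?C")
    case True
    then have "x \<bullet> b \<in> {0..1}" if "b \<in> Basis" for b
      using that by (auto simp: mem_box Basis_vec_def inner_axis mem_box_cart)
    with True show ?thesis by simp
  next
    case False
    then obtain i where "x $ i \<notin> {0..1}" by (auto simp: mem_box_cart)
    then have "x \<bullet> axis i 1 \<notin> {0..1}" by (simp add: inner_axis)
    moreover have "axis i 1 \<in> (Basis :: (real^'d) set)" by (auto simp: Basis_vec_def)
    ultimately show ?thesis using False
      by (subst prod_zero) (auto intro!: bexI[of _ "axis i 1"])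
  qed
  have eq: "indicator ?C x *\<^sub>R fourier_char k x = (\<Prod>b\<in>Basis. ?f b (x \<bullet> b))" for x
    unfolding ind fourier_char_prod by (simp add: scaleR_conv_of_real prod.distrib)
  have fm: "fourier_char k \<in> borel_measurable borel"
    by (intro borel_measurable_continuous_onI continuous_intros)
  \<comment> \<open>The restriction becomes an indicator factor, and Borel measurability of the
    integrand allows passing from \<open>lebesgue\<close> to \<open>lborel\<close>, where the
    product formula applies.\<close>
  have "(LINT x|torus_measure. fourier_char k x) =
      (LINT x|lebesgue. indicator ?C x *\<^sub>R fourier_char k x)"
    unfolding torus_measure_def by (rule integral_restrict_space) auto
  also have "\<dots> = (LINT x|lborel. indicator ?C x *\<^sub>R fourier_char k x)"
    using fm by (intro integral_completion) auto
  also have "\<dots> = (LINT x|lborel. (\<Prod>b\<in>Basis. ?f b (x \<bullet> b)))"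
    by (simp only: eq)
  also have "\<dots> = (\<Prod>b\<in>Basis. (LINT t|lborel. ?f b t))"
    by (intro integral_lborel_prod borel_integrable_compact[unfolded set_integrable_def])
       (auto intro!: continuous_intros)
  also have "\<dots> = (\<Prod>b\<in>Basis. if k \<bullet> b = 0 then 1 else 0)"
    by (intro prod.cong refl integral_cis_unit_interval int)
  also have "\<dots> = (if k = 0 then 1 else 0)"
    by (auto simp: euclidean_eq_iff[of k] prod_zero_iff)
  finally show ?thesis .
qed

section \<open>Iterated derivatives and test functions\<close>

lemma partial_deriv_has_derivative:
  assumes "(f has_derivative f') (at x)"
  shows "partial_deriv i f x = f' (axis i 1)"
  by (simp add: partial_deriv_def frechet_derivative_at[OF assms, symmetric])

lemma partial_derivs_simps [simp]:
  "partial_derivs [] f = f"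
  "partial_derivs (i # is) f = partial_deriv i (partial_derivs is f)"
  by (simp_all add: partial_derivs_def)

text \<open>Smoothness makes every iterated derivative differentiable, so the sum rule can be
  applied once per index.\<close>

lemma partial_derivs_add:
  assumes "smooth f" "smooth g"
  shows "partial_derivs is (\<lambda>x. f x + g x) = (\<lambda>x. partial_derivs is f x + partial_derivs is g x)"
proof (induction "is")
  case (Cons i "is")
  have "partial_deriv i (\<lambda>x. partial_derivs is f x + partial_derivs is g x) y =
      partial_deriv i (partial_derivs is f) y + partial_deriv i (partial_derivs is g) y" for y
  proof -
    have "partial_derivs is f differentiable (at y)" "partial_derivs is g differentiable (at y)"
      using assms by (auto simp: smooth_def)
    then have "((\<lambda>x. partial_derivs is f x + partial_derivs is g x) has_derivative
        (\<lambda>h. frechet_derivative (partial_derivs is f) (at y) h +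
             frechet_derivative (partial_derivs is g) (at y) h)) (at y)"
      by (intro has_derivative_add) (simp_all add: frechet_derivative_works)
    from partial_deriv_has_derivative[OF this] show ?thesis
      by (simp add: partial_deriv_def)
  qed
  then show ?case by (simp add: Cons fun_eq_iff)
qed simp

lemma partial_derivs_cmult:
  fixes f :: "real^'d::finite \<Rightarrow> 'b::real_normed_algebra"
  assumes "smooth f"
  shows "partial_derivs is (\<lambda>x. c * f x) = (\<lambda>x. c * partial_derivs is f x)"
proof (induction "is")
  case (Cons i "is")
  have "partial_deriv i (\<lambda>x. c * partial_derivs is f x) y =
      c * partial_deriv i (partial_derivs is f) y" for y
  proof -
    have "partial_derivs is f differentiable (at y)"
      using assms by (auto simp: smooth_def)
    then have "((\<lambda>x. c * partial_derivs is f x) has_derivative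
        (\<lambda>h. c * frechet_derivative (partial_derivs is f) (at y) h)) (at y)"
      by (intro has_derivative_mult_right) (simp add: frechet_derivative_works)
    from partial_deriv_has_derivative[OF this] show ?thesis
      by (simp add: partial_deriv_def)
  qed
  then show ?case by (simp add: Cons fun_eq_iff)
qed simp

lemma test_fun_add:
  assumes "\<psi> \<in> test_fun" "\<eta> \<in> test_fun"
  shows "(\<lambda>x. \<psi> x + \<eta> x) \<in> test_fun"
proof -
  have "smooth (\<lambda>x. \<psi> x + \<eta> x)"
    using assms partial_derivs_add[of \<psi> \<eta>]
    by (auto simp: test_fun_def smooth_def intro: differentiable_add)
  with assms show ?thesis by (auto simp: test_fun_def periodic_def)
qed

lemma test_fun_cmult:
  assumes "\<psi> \<in> test_fun"
  shows "(\<lambda>x. c * \<psi> x) \<in> test_fun"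
proof -
  have "smooth (\<lambda>x. c * \<psi> x)"
    using assms partial_derivs_cmult[of \<psi>]
    by (auto simp: test_fun_def smooth_def intro: differentiable_mult)
  with assms show ?thesis by (auto simp: test_fun_def periodic_def)
qed

text \<open>The factor \<open>c\<close> makes the rule applicable again to its own output, as the
  induction over iterated derivatives of a character requires.\<close>

lemma has_derivative_fourier_char:
  "((\<lambda>x. c * fourier_char k x) has_derivative
     (\<lambda>h. c * (\<i> * of_real (2 * pi * (k \<bullet> h)) * fourier_char k x))) (at x)"
proof -
  have "((\<lambda>x. \<i> * of_real (2 * pi * (k \<bullet> x))) has_derivative
      (\<lambda>h. \<i> * of_real (2 * pi * (k \<bullet> h)))) (at x)"
    by (auto intro!: derivative_eq_intros)
  from has_derivative_mult_right[OF has_derivative_compose[OF this DERIV_exp[unfolded has_field_derivative_def]], of c]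
  show ?thesis
    unfolding fourier_char_def cis_conv_exp by (simp add: mult_ac)
qed

lemma int_lattice_uminus: "k \<in> int_lattice \<Longrightarrow> - k \<in> int_lattice"
  by (auto simp: int_lattice_def)

lemma int_lattice_diff: "k \<in> int_lattice \<Longrightarrow> m \<in> int_lattice \<Longrightarrow> k - m \<in> int_lattice"
  by (auto simp: int_lattice_def)

lemma fourier_char_test_fun:
  fixes k :: "real^'d::finite"
  assumes "k \<in> int_lattice"
  shows "fourier_char k \<in> test_fun"
proof -
  have "\<exists>c. partial_derivs is (fourier_char k) = (\<lambda>x. c * fourier_char k x)" for "is"
  proof (induction "is")
    case Nil
    show ?case by (auto intro!: exI[of _ 1])
  next
    case (Cons i "is")
    then obtain c where c: "partial_derivs is (fourier_char k) = (\<lambda>x. c * fourier_char k x)"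
      by blast
    show ?case
      by (rule exI[of _ "c * (\<i> * of_real (2 * pi * (k \<bullet> axis i 1)))"])
         (simp add: c fun_eq_iff partial_deriv_has_derivative[OF has_derivative_fourier_char])
  qed
  then have "smooth (fourier_char k)"
    unfolding smooth_def by (metis differentiableI has_derivative_fourier_char)
  moreover have "periodic (fourier_char k)"
    unfolding periodic_def
  proof (intro ballI allI)
    fix m x :: "real^'d" assume "m \<in> int_lattice"
    with assms have "k \<bullet> m \<in> \<int>"
      by (auto simp: inner_vec_def int_lattice_def intro!: Ints_sum)
    then have "cis (2 * pi * (k \<bullet> m)) = 1" by (rule cis_multiple_2pi)
    then show "fourier_char k (x + m) = fourier_char k x"
      by (simp add: fourier_char_def inner_add_right distrib_left cis_mult[symmetric])
  qed
  ultimately show ?thesis by (simp add: test_fun_def)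
qed

section \<open>Characters as distributions\<close>

text \<open>The pairing is bilinear, without conjugation. Since \<open>fourier_coeff\<close> tests
  against the character of the negated frequency, the only nonzero Fourier coefficient sits at
  \<open>k\<close> itself.\<close>

definition char_distr :: "real^'d::finite \<Rightarrow> (real^'d \<Rightarrow> complex) \<Rightarrow> complex" where
  "char_distr k \<psi> = (if \<psi> \<in> test_fun then LINT x|torus_measure. \<psi> x * fourier_char k x else 0)"

lemma emeasure_torus: "emeasure torus_measure (space torus_measure) = 1"
proof -
  have "emeasure lborel (cbox 0 (\<chi> i. 1) :: (real^'a) set) = 1"
    by (subst emeasure_lborel_cbox) (auto simp: Basis_vec_def inner_axis inner_diff_left intro!: prod.neutral)
  then show ?thesis
    by (simp add: torus_measure_def emeasure_restrict_space)
qed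

lemma test_fun_continuous: "\<psi> \<in> test_fun \<Longrightarrow> continuous_on S \<psi>"
  unfolding test_fun_def smooth_def
  by (metis (lifting) continuous_at_imp_continuous_on differentiable_imp_continuous_within
      mem_Collect_eq partial_derivs_simps(1))

lemma integrable_test_fun_char:
  "\<psi> \<in> test_fun \<Longrightarrow> integrable torus_measure (\<lambda>x. \<psi> x * fourier_char k x)"
  unfolding torus_measure_def
  by (intro continuous_imp_integrable continuous_intros test_fun_continuous)

text \<open>The functional has order zero: the torus has measure one and characters have modulus
  one, so N = 0 and C = \<open>norm c\<close> serve in the continuity bound.\<close>

lemma char_distr_torus_distr:
  fixes k :: "real^'d::finite"
  shows "(\<lambda>\<psi>. c * char_distr k \<psi>) \<in> torus_distr"
proof -
  interpret finite_measure "torus_measure :: (real^'d) measure"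
    by standard (simp add: emeasure_torus)
  have "norm (c * char_distr k \<psi>) \<le> norm c * B"
    if "\<psi> \<in> test_fun" and bd: "\<And>is x. length is \<le> 0 \<Longrightarrow> norm (partial_derivs is \<psi> x) \<le> B" for \<psi> B
  proof -
    have B: "norm (\<psi> x) \<le> B" for x using bd[of "[]"] by simp
    have "norm (LINT x|torus_measure. \<psi> x * fourier_char k x) \<le>
        (LINT x|torus_measure. norm (\<psi> x * fourier_char k x))"
      by (rule integral_norm_bound)
    also have "\<dots> \<le> (LINT x|(torus_measure :: (real^'d) measure). B)"
      using B integrable_norm[OF integrable_test_fun_char[OF that(1)]]
      by (intro integral_mono) (auto simp: norm_mult)
    also have "\<dots> = B" by (simp add: measure_def emeasure_torus)
    finally show ?thesis using that(1)
      by (auto simp: char_distr_def norm_mult intro!: mult_left_mono)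
  qed
  then have "\<exists>N C. \<forall>\<psi>\<in>test_fun. \<forall>B.
      (\<forall>is x. length is \<le> N \<longrightarrow> norm (partial_derivs is \<psi> x) \<le> B) \<longrightarrow>
      norm (c * char_distr k \<psi>) \<le> C * B"
    by blast
  moreover have "c * char_distr k (\<lambda>x. \<psi> x + \<eta> x) = c * char_distr k \<psi> + c * char_distr k \<eta>"
    if "\<psi> \<in> test_fun" "\<eta> \<in> test_fun" for \<psi> \<eta>
    using that by (simp add: char_distr_def test_fun_add distrib_left distrib_right
        integrable_test_fun_char)
  moreover have "c * char_distr k (\<lambda>x. b * \<psi> x) = b * (c * char_distr k \<psi>)"
    if "\<psi> \<in> test_fun" for \<psi> b
    using that by (simp add: char_distr_def test_fun_cmult mult.assoc mult.left_commute)
  ultimately show ?thesis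
    by (simp add: torus_distr_def char_distr_def)
qed

lemma torus_distr_diff:
  assumes "u \<in> torus_distr" "v \<in> torus_distr"
  shows "u - v \<in> torus_distr"
proof -
  let ?bd = "\<lambda>w N C. \<forall>\<psi>\<in>test_fun. \<forall>B.
      (\<forall>is x. length is \<le> N \<longrightarrow> norm (partial_derivs is \<psi> x) \<le> B) \<longrightarrow> norm (w \<psi>) \<le> C * B"
  from assms obtain N1 C1 N2 C2 where b1: "?bd u N1 C1" and b2: "?bd v N2 C2"
    unfolding torus_distr_def by auto
  \<comment> \<open>A bound on derivatives up to the larger order supplies the premises of both
    estimates.\<close>
  have "?bd (u - v) (max N1 N2) (C1 + C2)"
  proof (intro ballI allI impI)
    fix \<psi> :: "real^'a \<Rightarrow> complex" and B
    assume \<psi>: "\<psi> \<in> test_fun"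
      and B: "\<forall>is x. length is \<le> max N1 N2 \<longrightarrow> norm (partial_derivs is \<psi> x) \<le> B"
    have "norm (u \<psi>) \<le> C1 * B" "norm (v \<psi>) \<le> C2 * B"
      using b1 b2 \<psi> B by auto
    then show "norm ((u - v) \<psi>) \<le> (C1 + C2) * B"
      using norm_triangle_ineq4[of "u \<psi>" "v \<psi>"] by (simp add: algebra_simps)
  qed
  then have "\<exists>N C. ?bd (u - v) N C" by blast
  with assms show ?thesis
    unfolding torus_distr_def by (auto simp: algebra_simps)
qed

lemma fourier_coeff_char_distr:
  assumes "k \<in> int_lattice" "m \<in> int_lattice"
  shows "fourier_coeff (\<lambda>\<psi>. c * char_distr k \<psi>) m = (if m = k then c else 0)"
proof -
  have "(LINT x|torus_measure. fourier_char (- m) x * fourier_char k x) = (if m = k then 1 else 0)"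
    using integral_fourier_char[OF int_lattice_diff[OF assms]]
    by (auto simp: fourier_char_mult)
  then show ?thesis
    by (simp add: fourier_coeff_def char_distr_def fourier_char_test_fun assms int_lattice_uminus)
qed

section \<open>Littlewood-Paley blocks and Besov norms of one dyadic mode\<close>

lemma finite_bounded_int_lattice: "finite {k \<in> int_lattice. norm (k :: real^'d::finite) < r}"
proof (rule finite_subset)
  let ?A = "{-\<lceil>r\<rceil>..\<lceil>r\<rceil>}"
  show "{k \<in> int_lattice. norm (k :: real^'d::finite) < r} \<subseteq>
      (\<lambda>f. \<chi> i. of_int (f i)) ` (UNIV \<rightarrow>\<^sub>E ?A)"
  proof
    fix k :: "real^'d" assume k: "k \<in> {k \<in> int_lattice. norm k < r}"
    then have eq: "of_int \<lfloor>k $ i\<rfloor> = k $ i" for i by (auto simp: int_lattice_def)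
    have "\<bar>k $ i\<bar> < r" for i using k component_le_norm_cart[of k i] by simp
    then have "\<bar>of_int \<lfloor>k $ i\<rfloor>\<bar> \<le> real_of_int \<lceil>r\<rceil>" for i
      unfolding eq using le_of_int_ceiling[of r] by (meson less_eq_real_def order_trans)
    then have "\<lfloor>k $ i\<rfloor> \<in> ?A" for i by (simp add: abs_le_iff) (smt (verit) of_int_le_iff of_int_minus)
    then show "k \<in> (\<lambda>f. \<chi> i. of_int (f i)) ` (UNIV \<rightarrow>\<^sub>E ?A)"
      by (intro image_eqI[of _ _ "\<lambda>i. \<lfloor>k $ i\<rfloor>"]) (auto simp: vec_eq_iff eq)
  qed
qed (intro finite_imageI finite_PiE, auto)

text \<open>The scaled vector has norm 2^(n-m), which is at most 1 or at least 2. It never meets the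
  transition annulus, where the values of \<phi> are not prescribed.\<close>

lemma dyadic_generator_scaled:
  fixes k :: "real^'d::finite"
  assumes "dyadic_generator \<phi>" "norm k = 2 ^ n"
  shows "\<phi> (k /\<^sub>R 2 ^ m) = (if n \<le> m then 1 else 0)"
proof (cases "n \<le> m")
  case True
  then have "(2::real) ^ n \<le> 2 ^ m" by (intro power_increasing) auto
  then show ?thesis using assms True by (simp add: dyadic_generator_def field_simps)
next
  case False
  then have "(2::real) ^ Suc m \<le> 2 ^ n" by (intro power_increasing) auto
  then show ?thesis using assms False by (simp add: dyadic_generator_def field_simps)
qed

text \<open>As j grows, \<phi> at k / 2^j jumps from 0 to 1 exactly at j = n; the cutoff is the
  increment of this step function.\<close>

lemma dyadic_cutoff_power2:
  fixes k :: "real^'d::finite"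
  assumes "dyadic_generator \<phi>" "norm k = 2 ^ n" "n > 0"
  shows "dyadic_cutoff \<phi> j k = (if j = n then 1 else 0)"
  using dyadic_generator_scaled[OF assms(1,2)] dyadic_generator_scaled[OF assms(1,2), of 0] assms(3)
  by (auto simp: dyadic_cutoff_def)

text \<open>Beyond radius 2^(j+1) all arguments of \<phi> in the cutoff have norm at least 2.
  Finiteness matters because HOL sums over infinite sets are 0 by default.\<close>

lemma finite_dyadic_cutoff_support:
  fixes \<phi> :: "real^'d::finite \<Rightarrow> real"
  assumes "dyadic_generator \<phi>"
  shows "finite {k \<in> int_lattice. dyadic_cutoff \<phi> j k \<noteq> 0}"
proof (rule finite_subset[OF _ finite_bounded_int_lattice[of "2 ^ (j + 1)"]], safe, rule ccontr)
  fix k :: "real^'d"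
  assume nz: "dyadic_cutoff \<phi> j k \<noteq> 0" and "\<not> norm k < 2 ^ (j + 1)"
  then have large: "2 ^ (j + 1) \<le> norm k" by simp
  have zero: "\<phi> (k /\<^sub>R 2 ^ m) = 0" if "m \<le> j" for m
  proof -
    have "(2::real) ^ Suc m \<le> 2 ^ (j + 1)" using that by (intro power_increasing) auto
    with large have "2 ^ Suc m \<le> norm k" by linarith
    then have "2 \<le> norm (k /\<^sub>R 2 ^ m)" by (simp add: field_simps)
    with assms show ?thesis by (auto simp: dyadic_generator_def)
  qed
  from nz zero[of 0] zero[of j] zero[of "j - 1"] show False
    by (auto simp: dyadic_cutoff_def split: if_splits)
qed

lemma torus_Lp_norm_cong:
  "(\<And>x. norm (f x) = norm (g x)) \<Longrightarrow> torus_Lp_norm p f = torus_Lp_norm p g"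
  by (simp add: torus_Lp_norm_def)

lemma torus_Lp_norm_const:
  assumes "p \<noteq> 0"
  shows "torus_Lp_norm p (\<lambda>x. c) = norm c"
  using assms by (simp add: torus_Lp_norm_def measure_def emeasure_torus powr_powr)

context
  fixes \<phi> :: "real^'d::finite \<Rightarrow> real" and k :: "real^'d" and n :: nat
  assumes \<phi>: "dyadic_generator \<phi>"
    and k: "k \<in> int_lattice" "norm k = 2 ^ n" and n: "n > 0"
begin

lemma lp_block_char_distr:
  "lp_block \<phi> j (\<lambda>\<psi>. c * char_distr k \<psi>) x = (if j = n then c * fourier_char k x else 0)"
proof -
  let ?S = "{m \<in> int_lattice. dyadic_cutoff \<phi> j m \<noteq> 0}"
  have "lp_block \<phi> j (\<lambda>\<psi>. c * char_distr k \<psi>) x =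
      (\<Sum>m\<in>?S. if m = k then of_real (dyadic_cutoff \<phi> j k) * c * fourier_char k x else 0)"
    unfolding lp_block_def using k(1) by (intro sum.cong) (auto simp: fourier_coeff_char_distr)
  also have "\<dots> = (if j = n then c * fourier_char k x else 0)"
    using k(1) by (subst sum.delta[OF finite_dyadic_cutoff_support[OF \<phi>]])
      (auto simp: dyadic_cutoff_power2[OF \<phi> k(2) n])
  finally show ?thesis .
qed

lemma besov_seq_char_distr:
  assumes "p \<noteq> 0"
  shows "besov_seq \<phi> s p (\<lambda>\<psi>. c * char_distr k \<psi>) j =
    (if j = n then 2 powr (real n * s) * norm c else 0)"
proof -
  \<comment> \<open>The norm sees only the modulus, and characters have modulus one, so the block
    may be replaced by a constant.\<close>
  have "torus_Lp_norm p (lp_block \<phi> j (\<lambda>\<psi>. c * char_distr k \<psi>)) =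
      torus_Lp_norm p (\<lambda>x :: real^'d. if j = n then c else 0)"
    by (rule torus_Lp_norm_cong) (simp add: lp_block_char_distr norm_mult)
  then show ?thesis
    by (simp add: besov_seq_def torus_Lp_norm_const[OF assms])
qed

lemma besov_char_distr:
  assumes "p \<noteq> 0" "q > 0"
  shows "(\<lambda>\<psi>. c * char_distr k \<psi>) \<in> besov \<phi> s p q"
proof (cases "q = \<infinity>")
  case True
  then show ?thesis
    by (auto simp: besov_def char_distr_torus_distr besov_seq_char_distr[OF assms(1)]
        intro!: bdd_aboveI[of _ "2 powr (real n * s) * norm c"])
next
  case False
  have "summable (\<lambda>j. besov_seq \<phi> s p (\<lambda>\<psi>. c * char_distr k \<psi>) j powr real_of_ereal q)"
    \<comment> \<open>In HOL \<open>0 powr t\<close> is 0 for every t, so all terms other than the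
      n-th vanish.\<close>
    by (rule summable_finite[of "{n}"]) (auto simp: besov_seq_char_distr[OF assms(1)])
  then show ?thesis using False by (simp add: besov_def char_distr_torus_distr)
qed

text \<open>The sequence has one nonzero entry, which both the supremum and the q-sum return. The
  value depends on neither p nor q, so one amplitude controls the norms in all three spaces of the
  theorem.\<close>

lemma besov_norm_char_distr:
  assumes "p \<noteq> 0" "q > 0"
  shows "besov_norm \<phi> s p q (\<lambda>\<psi>. c * char_distr k \<psi>) = 2 powr (real n * s) * norm c"
proof (cases "q = \<infinity>")
  case True
  have "(SUP j. if j = n then 2 powr (real n * s) * norm c else 0) = 2 powr (real n * s) * norm c"
    by (rule cSup_eq_maximum) auto
  with True show ?thesis
    by (simp add: besov_norm_def besov_seq_char_distr[OF assms(1)])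
next
  case False
  define r where "r = real_of_ereal q"
  have r: "r > 0" using False assms(2) by (cases q) (auto simp: r_def)
  have "(\<Sum>j. besov_seq \<phi> s p (\<lambda>\<psi>. c * char_distr k \<psi>) j powr r) =
      (\<Sum>j\<in>{n}. besov_seq \<phi> s p (\<lambda>\<psi>. c * char_distr k \<psi>) j powr r)"
    by (rule suminf_finite) (auto simp: besov_seq_char_distr[OF assms(1)])
  also have "\<dots> = (2 powr (real n * s) * norm c) powr r"
    by (simp add: besov_seq_char_distr[OF assms(1)])
  finally show ?thesis using False r
    by (simp add: besov_norm_def powr_powr flip: r_def)
qed

text \<open>The two distributions differ only in the block \<open>n\<close>, so that no triangle inequality in
  \<open>L\<^sup>p\<close> or \<open>\<ell>\<^sup>q\<close> is needed.\<close>

lemma besov_char_distr_diff: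
  assumes "u \<in> besov \<phi> s p q"
  shows "(\<lambda>\<psi>. c * char_distr k \<psi>) - u \<in> besov \<phi> s p q"
proof -
  let ?f = "\<lambda>\<psi>. c * char_distr k \<psi>"
  \<comment> \<open>For j different from n the cutoff vanishes at k, so the sum omits the only
    frequency at which the character contributes.\<close>
  have block: "lp_block \<phi> j (?f - u) x = - lp_block \<phi> j u x" if "j \<noteq> n" for j x
    unfolding lp_block_def sum_negf[symmetric]
  proof (rule sum.cong)
    fix m assume m: "m \<in> {m \<in> int_lattice. dyadic_cutoff \<phi> j m \<noteq> 0}"
    then have "m \<noteq> k" using that by (auto simp: dyadic_cutoff_power2[OF \<phi> k(2) n])
    then have "fourier_coeff (?f - u) m = - fourier_coeff u m"
      using fourier_coeff_char_distr[OF k(1), of m c] m by (simp add: fourier_coeff_def)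
    then show "of_real (dyadic_cutoff \<phi> j m) * fourier_coeff (?f - u) m * fourier_char m x =
        - (of_real (dyadic_cutoff \<phi> j m) * fourier_coeff u m * fourier_char m x)"
      by simp
  qed simp
  then have seq: "besov_seq \<phi> s p (?f - u) j = besov_seq \<phi> s p u j" if "j \<noteq> n" for j
    using that by (auto simp: besov_seq_def intro!: torus_Lp_norm_cong)
  have distr: "?f - u \<in> torus_distr"
    using assms by (intro torus_distr_diff char_distr_torus_distr) (simp add: besov_def)
  show ?thesis
  proof (cases "q = \<infinity>")
    case True
    then have "bdd_above (range (besov_seq \<phi> s p u))" using assms by (simp add: besov_def)
    \<comment> \<open>Changing one entry of a sequence adds at most one value to its range.\<close>
    then have "bdd_above (insert (besov_seq \<phi> s p (?f - u) n) (range (besov_seq \<phi> s p u)))"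
      by simp
    moreover have "range (besov_seq \<phi> s p (?f - u)) \<subseteq>
        insert (besov_seq \<phi> s p (?f - u) n) (range (besov_seq \<phi> s p u))"
      using seq by auto (metis rangeI)
    ultimately have "bdd_above (range (besov_seq \<phi> s p (?f - u)))"
      by (rule bdd_above_mono)
    with True distr show ?thesis by (simp add: besov_def)
  next
    case False
    \<comment> \<open>Beyond index n the two series agree, and summability depends only on the
      tail.\<close>
    have "\<forall>\<^sub>F j in sequentially. besov_seq \<phi> s p (?f - u) j powr real_of_ereal q =
        besov_seq \<phi> s p u j powr real_of_ereal q"
      using eventually_gt_at_top[of n] by eventually_elim (simp add: seq)
    from summable_cong[OF this] show ?thesis
      using assms False distr by (simp add: besov_def)
  qed
qed

end

section \<open>Equivalent norms and the worst case error\<close>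

lemma equivalent_norm_bounds:
  assumes "equivalent_norm V N\<^sub>0 N"
  obtains c C where "0 < c" "0 < C"
    "\<And>u. u \<in> V \<Longrightarrow> c * N\<^sub>0 u \<le> N u" "\<And>u. u \<in> V \<Longrightarrow> N u \<le> C * N\<^sub>0 u"
proof -
  from assms have "\<exists>c C. 0 < c \<and> 0 < C \<and> (\<forall>u\<in>V. c * N\<^sub>0 u \<le> N u \<and> N u \<le> C * N\<^sub>0 u)"
    unfolding equivalent_norm_def by (elim conjE)
  then show ?thesis using that by auto
qed

lemma equivalent_norm_zero: "equivalent_norm V N\<^sub>0 N \<Longrightarrow> 0 \<in> V \<Longrightarrow> N 0 = 0"
  by (simp add: equivalent_norm_def)

lemma equivalent_norm_uminus:
  assumes "equivalent_norm V N\<^sub>0 N" "v \<in> V"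
  shows "N (0 - v) = N v"
proof -
  have "0 - v = (\<lambda>\<psi>. (-1) * v \<psi>)" by (simp add: fun_eq_iff)
  moreover have "N (\<lambda>\<psi>. (-1) * v \<psi>) = norm (-1 :: complex) * N v"
    using assms unfolding equivalent_norm_def by blast
  ultimately show ?thesis by simp
qed

text \<open>The triangle inequality is available only on V, hence the membership premises for both
  summands of u = (u - v) + v.\<close>

lemma equivalent_norm_diff_triangle:
  assumes "equivalent_norm V N\<^sub>0 N" "u - v \<in> V" "v \<in> V"
  shows "N u \<le> N (u - v) + N v"
proof -
  have "(u - v) + v = u" by (simp add: fun_eq_iff)
  moreover have "N ((u - v) + v) \<le> N (u - v) + N v"
    using assms unfolding equivalent_norm_def by blast
  ultimately show ?thesis by simp
qed

text \<open>Finiteness is essential for the real-valued form: \<open>enn2real\<close> sends an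
  infinite error to 0.\<close>

lemma worst_case_error_ge:
  assumes "worst_case_error N K F R \<delta> < \<infinity>"
    and "f \<in> K" "g \<in> torus_Lp 2" "torus_Lp_norm 2 (F f - g) \<le> \<delta>"
  shows "N (f - R g) \<le> enn2real (worst_case_error N K F R \<delta>)"
proof -
  have "ennreal (N (f - R g)) \<le> worst_case_error N K F R \<delta>"
    unfolding worst_case_error_def by (rule SUP_upper2[of "(f, g)"]) (use assms in auto)
  also have "\<dots> = ennreal (enn2real (worst_case_error N K F R \<delta>))"
    using assms(1) by simp
  finally show ?thesis by (simp add: ennreal_le_iff)
qed

section \<open>The lower bound along a sequence of noise levels and the contradiction\<close>

theorem theorem4p12:
  fixes \<phi> :: "real^'d::finite \<Rightarrow> real"
    and p q a s \<rho> L :: real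
    and N0 Ns Na :: "((real^'d \<Rightarrow> complex) \<Rightarrow> complex) \<Rightarrow> real"
    and D :: "((real^'d \<Rightarrow> complex) \<Rightarrow> complex) set"
    and F :: "((real^'d \<Rightarrow> complex) \<Rightarrow> complex) \<Rightarrow> real^'d \<Rightarrow> complex"
  assumes "dyadic_generator \<phi>"
    and "1 < p" "p \<le> 2" "1 < q"
    and "a > 0" "a > real CARD('d) / p - real CARD('d) / 2" "s > 0" "\<rho> > 0"
    and "equivalent_norm (besov \<phi> 0 p (ereal q)) (besov_norm \<phi> 0 p (ereal q)) N0"
    and "equivalent_norm (besov \<phi> s p \<infinity>) (besov_norm \<phi> s p \<infinity>) Ns"
    and "equivalent_norm (besov \<phi> (- a) 2 (ereal 2)) (besov_norm \<phi> (- a) 2 (ereal 2)) Na"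
    and "D \<subseteq> besov \<phi> 0 p (ereal q)"
    and "{f \<in> besov \<phi> s p \<infinity>. Ns f \<le> \<rho>} \<subseteq> D"
    and "\<forall>f\<in>D. F f \<in> torus_Lp 2"
    and "L > 0"
    and "\<forall>f1\<in>D. \<forall>f2\<in>D. torus_Lp_norm 2 (F f1 - F f2) \<le> L * Na (f1 - f2)"
  shows "\<not> (\<exists>R. reconstruction_method (besov \<phi> 0 p (ereal q)) R \<and>
    (let E = worst_case_error N0 {f \<in> besov \<phi> s p \<infinity>. Ns f \<le> \<rho>} F R in
      (\<forall>\<^sub>F \<delta> in at_right 0. E \<delta> < \<infinity>) \<and>
      (\<lambda>\<delta>. enn2real (E \<delta>)) \<in>
        o[at_right 0](\<lambda>\<delta>. \<rho> powr (a / (s + a)) * \<delta> powr (s / (s + a)))))"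
proof (rule notI, elim exE conjE, unfold Let_def, elim conjE)
  fix R
  define K where "K = {f \<in> besov \<phi> s p \<infinity>. Ns f \<le> \<rho>}"
  define E where "E = worst_case_error N0 K F R"
  define r where "r = s / (s + a)"
  define P where "P = \<rho> powr (a / (s + a))"
  assume R: "reconstruction_method (besov \<phi> 0 p (ereal q)) R"
    and "\<forall>\<^sub>F \<delta> in at_right 0. worst_case_error N0 {f \<in> besov \<phi> s p \<infinity>. Ns f \<le> \<rho>} F R \<delta> < \<infinity>"
    and "(\<lambda>\<delta>. enn2real (worst_case_error N0 {f \<in> besov \<phi> s p \<infinity>. Ns f \<le> \<rho>} F R \<delta>)) \<in>
        o[at_right 0](\<lambda>\<delta>. \<rho> powr (a / (s + a)) * \<delta> powr (s / (s + a)))"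
  then have fin: "\<forall>\<^sub>F \<delta> in at_right 0. E \<delta> < \<infinity>"
    and small: "(\<lambda>\<delta>. enn2real (E \<delta>)) \<in> o[at_right 0](\<lambda>\<delta>. P * \<delta> powr r)"
    by (simp_all add: E_def K_def P_def r_def)

  \<comment> \<open>The lower bound on \<open>N0\<close> keeps the error large; the upper bounds on
    \<open>Ns\<close> and \<open>Na\<close> keep the mode in the source set and its data close to
    \<open>F 0\<close>.\<close>
  obtain c0 where c0: "c0 > 0"
    "\<And>u. u \<in> besov \<phi> 0 p (ereal q) \<Longrightarrow> c0 * besov_norm \<phi> 0 p (ereal q) u \<le> N0 u"
    by (rule equivalent_norm_bounds[OF assms(9)]) blast
  obtain Cs where Cs: "Cs > 0"
    "\<And>u. u \<in> besov \<phi> s p \<infinity> \<Longrightarrow> Ns u \<le> Cs * besov_norm \<phi> s p \<infinity> u"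
    by (rule equivalent_norm_bounds[OF assms(10)]) blast
  obtain Ca where Ca: "Ca > 0"
    "\<And>u. u \<in> besov \<phi> (- a) 2 (ereal 2) \<Longrightarrow> Na u \<le> Ca * besov_norm \<phi> (- a) 2 (ereal 2) u"
    by (rule equivalent_norm_bounds[OF assms(11)]) blast

  \<comment> \<open>The Lipschitz estimate for the n-th mode evaluates to \<delta> n: its amplitude
    contributes the exponent s, the norm of order -a the exponent a.\<close>
  define A where "A = L * Ca * (\<rho> / Cs)"
  define \<delta> where "\<delta> n = A * 2 powr (- real n * (s + a))" for n :: nat
  have A: "A > 0" using assms(8,15) Ca(1) Cs(1) by (simp add: A_def)
  have P: "P > 0" using assms(8) by (simp add: P_def)

  have lower: "c0 * (\<rho> / Cs * 2 powr (- real n * s)) \<le> 2 * enn2real (E (\<delta> n))"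
    if n: "n > 0" and E: "E (\<delta> n) < \<infinity>" for n
  proof -
    \<comment> \<open>Here \<open>undefined\<close> is just some coordinate direction; any would
      do.\<close>
    define k :: "real^'d" where "k = 2 ^ n *\<^sub>R axis undefined 1"
    have k: "k \<in> int_lattice"
      by (auto simp: k_def int_lattice_def axis_def)
    have norm_k: "norm k = 2 ^ n"
      by (simp add: k_def)
    \<comment> \<open>The largest amplitude for which the upper bound with constant
      \<open>Cs\<close> guarantees \<open>Ns f\<close> at most \<rho>.\<close>
    define c :: real where "c = \<rho> / Cs * 2 powr (- real n * s)"
    have c: "c > 0" using assms(8) Cs(1) by (simp add: c_def)
    define f where "f \<psi> = of_real c * char_distr k \<psi>" for \<psi>
    note in_besov = besov_char_distr[OF assms(1) k norm_k n]
    note norm_char = besov_norm_char_distr[OF assms(1) k norm_k n]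
    \<comment> \<open>Reading 0 as a mode of amplitude zero lets the membership lemma for characters
      cover it too.\<close>
    have zero: "0 = (\<lambda>\<psi>. 0 * char_distr k \<psi>)" by (simp add: fun_eq_iff)
    have p: "p \<noteq> 0" and q: "0 < ereal q" using assms(2,4) by auto
    have 0: "0 \<in> K"
    proof -
      have "0 \<in> besov \<phi> s p \<infinity>" unfolding zero by (rule in_besov) (use p in auto)
      moreover from this have "Ns 0 = 0" by (rule equivalent_norm_zero[OF assms(10)])
      ultimately show ?thesis using assms(8) by (simp add: K_def)
    qed
    have f: "f \<in> K"
    proof -
      have fs: "f \<in> besov \<phi> s p \<infinity>" unfolding f_def by (rule in_besov) (use p in auto)
      have "besov_norm \<phi> s p \<infinity> f = 2 powr (real n * s) * c"
        unfolding f_def using c p by (subst norm_char) auto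
      also have "\<dots> = \<rho> / Cs" by (simp add: c_def powr_minus field_simps)
      finally have "Ns f \<le> \<rho>" using Cs(2)[OF fs] Cs(1) by simp
      with fs show ?thesis by (simp add: K_def)
    qed
    have fN: "c0 * c \<le> N0 f"
    proof -
      have "f \<in> besov \<phi> 0 p (ereal q)" unfolding f_def by (rule in_besov) (use p q in auto)
      moreover have "besov_norm \<phi> 0 p (ereal q) f = c"
        unfolding f_def using c p q by (subst norm_char) auto
      ultimately show ?thesis using c0(2) by metis
    qed
    have KD: "K \<subseteq> D" using assms(13) by (simp add: K_def)
    have F0: "F 0 \<in> torus_Lp 2" using 0 KD assms(14) by blast
    have "torus_Lp_norm 2 (F f - F 0) \<le> L * Na (f - 0)"
      using 0 f KD assms(16) by blast
    also have "\<dots> \<le> L * (Ca * (2 powr (real n * (- a)) * c))"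
    proof -
      have "f \<in> besov \<phi> (- a) 2 (ereal 2)" unfolding f_def by (rule in_besov) auto
      moreover have "besov_norm \<phi> (- a) 2 (ereal 2) f = 2 powr (real n * (- a)) * c"
        unfolding f_def using c by (subst norm_char) auto
      ultimately have "Na f \<le> Ca * (2 powr (real n * (- a)) * c)" using Ca(2) by metis
      then show ?thesis using assms(15) by simp
    qed
    also have "\<dots> = \<delta> n"
      by (simp add: \<delta>_def A_def c_def powr_add[symmetric] algebra_simps)
    finally have F1: "torus_Lp_norm 2 (F f - F 0) \<le> \<delta> n" .
    have F2: "torus_Lp_norm 2 (F 0 - F 0) \<le> \<delta> n"
    proof -
      have "F 0 - F 0 = (\<lambda>x. 0)" by (simp add: fun_eq_iff)
      then have "torus_Lp_norm 2 (F 0 - F 0) = 0" by (simp add: torus_Lp_norm_def)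
      then show ?thesis using A by (simp add: \<delta>_def)
    qed
    define v where "v = R (F 0)"
    have v: "v \<in> besov \<phi> 0 p (ereal q)"
      using R F0 by (simp add: reconstruction_method_def v_def)
    \<comment> \<open>Two-point argument: f and 0 share the admissible datum \<open>F 0\<close>,
      hence the same reconstruction v, and each of the two errors is at most the worst case
      error.\<close>
    have "N0 f \<le> N0 (f - v) + N0 v"
      by (rule equivalent_norm_diff_triangle[OF assms(9) _ v])
         (unfold f_def, rule besov_char_distr_diff[OF assms(1) k norm_k n v])
    also have "N0 v = N0 (0 - v)"
      using equivalent_norm_uminus[OF assms(9) v] by simp
    also have "N0 (f - v) + N0 (0 - v) \<le> enn2real (E (\<delta> n)) + enn2real (E (\<delta> n))"
      unfolding E_def v_def
      by (intro add_mono worst_case_error_ge E[unfolded E_def] f 0 F0 F1 F2)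
    finally show ?thesis using fN by (simp add: c_def)
  qed

  have "\<delta> \<longlonglongrightarrow> 0"
  proof -
    have "2 powr (- (s + a)) < 1"
      using powr_less_mono[of "- (s + a)" 0 2] assms(5,7) by simp
    then have "(\<lambda>n. A * (2 powr (- (s + a))) ^ n) \<longlonglongrightarrow> A * 0"
      by (intro tendsto_mult_left LIMSEQ_realpow_zero) auto
    moreover have "\<delta> n = A * (2 powr (- (s + a))) ^ n" for n
      by (simp add: \<delta>_def powr_realpow[symmetric] powr_powr algebra_simps)
    ultimately show ?thesis by (simp add: LIMSEQ_def)
  qed
  \<comment> \<open>Positivity of \<delta> n upgrades convergence to 0 to convergence from the
    right, so statements about small noise levels transfer to large n.\<close>
  then have lim: "filterlim \<delta> (at_right 0) sequentially"
    using A by (auto simp: filterlim_at \<delta>_def)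
  \<comment> \<open>Chosen so that the little-o bound at \<delta> n is a quarter of the left side of
    \<open>lower\<close>, while \<open>lower\<close> forces the error to be at least half of
    it.\<close>
  define \<epsilon> where "\<epsilon> = c0 * (\<rho> / Cs) / (4 * P * A powr r)"
  have "\<epsilon> > 0" using c0 Cs assms(8) P A by (simp add: \<epsilon>_def)
  with small have "\<forall>\<^sub>F \<delta> in at_right 0. norm (enn2real (E \<delta>)) \<le> \<epsilon> * norm (P * \<delta> powr r)"
    by (rule landau_o.smallD)
  with fin have "\<forall>\<^sub>F \<delta> in at_right 0. E \<delta> < \<infinity> \<and> enn2real (E \<delta>) \<le> \<epsilon> * norm (P * \<delta> powr r)"
    by eventually_elim simp
  from eventually_compose_filterlim[OF this lim]
  have "\<forall>\<^sub>F n in sequentially. E (\<delta> n) < \<infinity> \<and> enn2real (E (\<delta> n)) \<le> \<epsilon> * norm (P * \<delta> n powr r)" .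
  then have "\<forall>\<^sub>F n in sequentially. E (\<delta> n) < \<infinity> \<and>
      enn2real (E (\<delta> n)) \<le> \<epsilon> * norm (P * \<delta> n powr r) \<and> n > 0"
    using eventually_gt_at_top[of 0] by eventually_elim simp
  from eventually_happens'[OF _ this] obtain n where n: "E (\<delta> n) < \<infinity>" "enn2real (E (\<delta> n)) \<le> \<epsilon> * norm (P * \<delta> n powr r)" "n > 0"
    by auto
  \<comment> \<open>Since (s + a) r = s, the claimed rate at \<delta> n decays exactly like the
    amplitude of the mode.\<close>
  have eq: "\<delta> n powr r = A powr r * 2 powr (- real n * s)"
  proof -
    have "(s + a) * r = s" using assms(5,7) by (simp add: r_def)
    then have eq: "- real n * s = - real n * (s + a) * r" by (simp only: mult.assoc)
    show ?thesis using A unfolding \<delta>_def eq by (simp add: powr_mult powr_powr)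
  qed
  define T where "T = c0 * (\<rho> / Cs * 2 powr (- real n * s))"
  from eq n(2) P A have "enn2real (E (\<delta> n)) \<le> T / 4"
    by (simp add: T_def \<epsilon>_def abs_mult field_simps)
  moreover have "T > 0"
    using c0 Cs assms(8) by (simp add: T_def)
  ultimately show False
    using lower[OF n(3,1), folded T_def] by linarith
qed

end
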